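(* Let $G$ be a connected graph and $C\subseteq G$ a cycle. If $\sum_{e\in E(C)}x_e\le 2$ defines a facet of $\textsc{Bond}(G)$, then $C$ is maximal non-interleaved.
   Context: For a graph $G=(V,E)$ and $S\subseteq V$, the cut $\delta(S)=\{e\in E:|e\cap S|=1\}$ is a bond if $G[S]$ and $G[V\setminus S]$ are connected. $x^\delta$ is the incidence vector, $\textsc{Bond}(G)=\mathrm{conv}\{x^\delta:\delta\text{ a bond}\}$. A cycle $C\subseteq G$ is interleaved if there are vertices $v_1,v_2,v_3,v_4\in V(C)$ occurring along $C$ in this order and vertex-disjoint paths in $G-E(C)$ connecting $v_1$ with $v_3$ and $v_2$ with $v_4$, respectively; otherwise non-interleaved. A non-interleaved cycle $C$ is maximal non-interleaved if there is no non-interleaved cycle $C'$ with $|E(C)\setminus E(C')|=1$. *)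

theory Defs
  imports "HOL-Analysis.Analysis"
begin

record 'v ugraph =
  verts :: "'v set"
  edges :: "'v set set"

definition simple_graph :: "'v ugraph \<Rightarrow> bool" where
  "simple_graph G \<longleftrightarrow> finite (verts G) \<and> (\<forall>e\<in>edges G. e \<subseteq> verts G \<and> card e = 2)"

definition subgraph :: "'v ugraph \<Rightarrow> 'v ugraph \<Rightarrow> bool" where
  "subgraph H G \<longleftrightarrow> verts H \<subseteq> verts G \<and> edges H \<subseteq> edges G"

definition induced :: "'v ugraph \<Rightarrow> 'v set \<Rightarrow> 'v ugraph" where
  "induced G S = \<lparr>verts = S, edges = {e \<in> edges G. e \<subseteq> S}\<rparr>"

definition delete_edges :: "'v ugraph \<Rightarrow> 'v set set \<Rightarrow> 'v ugraph" where
  "delete_edges G F = \<lparr>verts = verts G, edges = edges G - F\<rparr>"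

definition path_between :: "'v ugraph \<Rightarrow> 'v \<Rightarrow> 'v list \<Rightarrow> 'v \<Rightarrow> bool" where
  "path_between G u p v \<longleftrightarrow> p \<noteq> [] \<and> hd p = u \<and> last p = v \<and> distinct p \<and>
     set p \<subseteq> verts G \<and> successively (\<lambda>a b. {a, b} \<in> edges G) p"

text \<open>The graph without vertices counts as connected. Hence for connected \<open>G\<close> the empty
  cut \<open>\<delta>(\<emptyset>)\<close> is a bond and the origin lies in the bond polytope.\<close>
definition connected_graph :: "'v ugraph \<Rightarrow> bool" where
  "connected_graph G \<longleftrightarrow> (\<forall>u\<in>verts G. \<forall>v\<in>verts G. \<exists>p. path_between G u p v)"

definition cut :: "'v ugraph \<Rightarrow> 'v set \<Rightarrow> 'v set set" where
  "cut G S = {e \<in> edges G. card (e \<inter> S) = 1}"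

definition is_bond :: "'v ugraph \<Rightarrow> 'v set set \<Rightarrow> bool" where
  "is_bond G d \<longleftrightarrow> (\<exists>S. S \<subseteq> verts G \<and> d = cut G S \<and>
     connected_graph (induced G S) \<and> connected_graph (induced G (verts G - S)))"

text \<open>\<open>\<real>\<^sup>E\<close> is embedded as a coordinate subspace of the space indexed by all sets of vertices:
  coordinates of non-edges are 0. Faces and affine dimensions do not depend on the ambient space.\<close>
definition incidence_vector :: "('v::finite) set set \<Rightarrow> real ^ ('v set)" where
  "incidence_vector d = (\<chi> e. if e \<in> d then 1 else 0)"

definition bond_polytope :: "('v::finite) ugraph \<Rightarrow> (real ^ ('v set)) set" where
  "bond_polytope G = convex hull {incidence_vector d | d. is_bond G d}"

definition defines_facet ::
    "('a::euclidean_space) set \<Rightarrow> ('a \<Rightarrow> real) \<Rightarrow> real \<Rightarrow> bool" where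
  "defines_facet P f b \<longleftrightarrow> linear f \<and> (\<forall>x\<in>P. f x \<le> b) \<and> {x \<in> P. f x = b} facet_of P"

text \<open>\<open>vs\<close> lists the vertices of the cycle \<open>C\<close> in an order in which they occur along \<open>C\<close>.\<close>
definition cycle_order :: "'v ugraph \<Rightarrow> 'v list \<Rightarrow> bool" where
  "cycle_order C vs \<longleftrightarrow> length vs \<ge> 3 \<and> distinct vs \<and> verts C = set vs \<and>
     edges C = {{vs ! i, vs ! (Suc i mod length vs)} | i. i < length vs}"

definition cycle_in :: "'v ugraph \<Rightarrow> 'v ugraph \<Rightarrow> bool" where
  "cycle_in G C \<longleftrightarrow> subgraph C G \<and> (\<exists>vs. cycle_order C vs)"

definition interleaved :: "'v ugraph \<Rightarrow> 'v ugraph \<Rightarrow> bool" where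
  "interleaved G C \<longleftrightarrow> (\<exists>vs i j k l p q. cycle_order C vs \<and>
     i < j \<and> j < k \<and> k < l \<and> l < length vs \<and>
     path_between (delete_edges G (edges C)) (vs ! i) p (vs ! k) \<and>
     path_between (delete_edges G (edges C)) (vs ! j) q (vs ! l) \<and>
     set p \<inter> set q = {})"

definition non_interleaved_cycle :: "'v ugraph \<Rightarrow> 'v ugraph \<Rightarrow> bool" where
  "non_interleaved_cycle G C \<longleftrightarrow> cycle_in G C \<and> \<not> interleaved G C"

definition maximal_non_interleaved :: "'v ugraph \<Rightarrow> 'v ugraph \<Rightarrow> bool" where
  "maximal_non_interleaved G C \<longleftrightarrow> non_interleaved_cycle G C \<and>
     \<not> (\<exists>C'. non_interleaved_cycle G C' \<and> card (edges C - edges C') = 1)"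

end

theory Submission imports Defs begin

text \<open>A cycle is non-interleaved iff every bond meets it in at most two edges: disjoint crossing
  paths are separated by a bond, and conversely the two sides of a bond meeting the cycle at least
  four times contain crossing paths off the cycle. So a valid cycle inequality comes from a
  non-interleaved cycle \<open>C\<close>. If \<open>C'\<close> is non-interleaved and contains all edges of \<open>C\<close> but one, then
  a bond meeting \<open>C\<close> twice meets \<open>C'\<close> at least once, hence by parity exactly twice. Thus
  \<open>x(C) - x(C')\<close> vanishes on the facet; it also vanishes at the origin, hence on all bonds. But the
  bonds span the edge space, so \<open>E(C) = E(C')\<close>, a contradiction.\<close>

section \<open>Reachability\<close>

text \<open>Edges and vertices are restricted by separate parameters, so deleting the cycle edges
  and confining walks to a vertex set can be combined freely.\<close>

definition adjacent_in :: "'v set set \<Rightarrow> 'v set \<Rightarrow> 'v \<Rightarrow> 'v \<Rightarrow> bool" where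
  "adjacent_in E X a b \<longleftrightarrow> {a, b} \<in> E \<and> a \<in> X \<and> b \<in> X"

abbreviation reachable :: "'v set set \<Rightarrow> 'v set \<Rightarrow> 'v \<Rightarrow> 'v \<Rightarrow> bool" where
  "reachable E X \<equiv> (adjacent_in E X)\<^sup>*\<^sup>*"

lemma reachable_sym: "reachable E X a b \<Longrightarrow> reachable E X b a"
proof (induction rule: rtranclp_induct)
  case (step y z)
  then have "adjacent_in E X z y"
    by (auto simp: adjacent_in_def insert_commute)
  then show ?case
    using step.IH by (rule converse_rtranclp_into_rtranclp)
qed simp

lemma reachable_mono:
  assumes "reachable E X a b" "E \<subseteq> E'" "X \<subseteq> X'"
  shows "reachable E' X' a b"
proof -
  have "adjacent_in E X \<le> adjacent_in E' X'"
    using assms by (auto simp: adjacent_in_def)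
  then show ?thesis
    using assms(1) rtranclp_mono by blast
qed

lemma reachable_in: "reachable E X a b \<Longrightarrow> a \<in> X \<Longrightarrow> b \<in> X"
  by (induction rule: rtranclp_induct) (auto simp: adjacent_in_def)

lemma reachable_hd_path:
  assumes "successively (\<lambda>a b. {a, b} \<in> E) p" "set p \<subseteq> X" "x \<in> set p"
  shows "reachable E X (hd p) x"
  using assms
proof (induction p)
  case (Cons a p)
  show ?case
  proof (cases "x = a")
    case False
    then have x: "x \<in> set p" and "p \<noteq> []" using Cons.prems by auto
    then have "adjacent_in E X a (hd p)" "successively (\<lambda>a b. {a, b} \<in> E) p"
      using Cons.prems by (auto simp: adjacent_in_def successively_Cons)
    then show ?thesis
      using Cons.IH Cons.prems x by (auto intro: converse_rtranclp_into_rtranclp)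
  qed simp
qed simp

lemma reachable_path:
  assumes "reachable E X u v" "u \<in> X"
  shows "\<exists>p. p \<noteq> [] \<and> hd p = u \<and> last p = v \<and> distinct p \<and> set p \<subseteq> X \<and>
    successively (\<lambda>a b. {a, b} \<in> E) p"
  using assms
proof (induction rule: rtranclp_induct)
  case base
  then show ?case by (intro exI[of _ "[u]"]) auto
next
  case (step y z)
  then obtain p where p: "p \<noteq> []" "hd p = u" "last p = y" "distinct p" "set p \<subseteq> X"
    "successively (\<lambda>a b. {a, b} \<in> E) p" by auto
  have yz: "{y, z} \<in> E" "z \<in> X" using step.hyps by (auto simp: adjacent_in_def)
  show ?case
  proof (cases "z \<in> set p")
    case False
    then show ?thesis
      using p yz by (intro exI[of _ "p @ [z]"]) (auto simp: successively_append_iff)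
  next
    case True
    \<comment> \<open>The walk returns to a vertex of the path built so far; cutting the path back
      to that vertex keeps it simple.\<close>
    then obtain xs ys where "p = xs @ z # ys" by (auto simp: in_set_conv_decomp)
    then show ?thesis
      using p yz
      by (intro exI[of _ "xs @ [z]"]) (auto simp: successively_append_iff hd_append split: if_splits)
  qed
qed

lemma path_between_reachable:
  assumes "path_between H u p v" "edges H \<subseteq> E" "set p \<subseteq> X" "x \<in> set p"
  shows "reachable E X u x"
proof -
  have "reachable (edges H) X (hd p) x"
    using assms by (intro reachable_hd_path) (auto simp: path_between_def)
  then have "reachable (edges H) X u x"
    using assms(1) by (simp add: path_between_def)
  then show ?thesis
    using assms(2) by (rule reachable_mono) simp
qed

lemma connected_graph_iff_reachable:
  "connected_graph H \<longleftrightarrow> (\<forall>u\<in>verts H. \<forall>v\<in>verts H. reachable (edges H) (verts H) u v)"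
proof -
  have "(\<exists>p. path_between H u p v) \<longleftrightarrow> reachable (edges H) (verts H) u v"
    if "u \<in> verts H" for u v
  proof
    assume "\<exists>p. path_between H u p v"
    then obtain p where p: "path_between H u p v" ..
    then have "set p \<subseteq> verts H" "v \<in> set p" by (auto simp: path_between_def)
    with p show "reachable (edges H) (verts H) u v"
      by (intro path_between_reachable) auto
  next
    assume "reachable (edges H) (verts H) u v"
    then show "\<exists>p. path_between H u p v"
      using reachable_path that unfolding path_between_def by metis
  qed
  then show ?thesis by (simp add: connected_graph_def)
qed

text \<open>\<open>adjacent_in\<close> already requires both ends in \<open>S\<close>, so walks in
  the induced graph can be described with the full edge set of \<open>G\<close>.\<close>

lemma connected_induced_iff:
  "connected_graph (induced G S) \<longleftrightarrow> (\<forall>u\<in>S. \<forall>v\<in>S. reachable (edges G) S u v)"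
proof -
  have "adjacent_in {e \<in> edges G. e \<subseteq> S} S = adjacent_in (edges G) S"
    by (auto simp: adjacent_in_def fun_eq_iff)
  then show ?thesis by (simp add: connected_graph_iff_reachable induced_def)
qed

lemma connected_inducedI:
  assumes "\<And>v. v \<in> S \<Longrightarrow> reachable (edges G) S u v"
  shows "connected_graph (induced G S)"
  unfolding connected_induced_iff
proof (intro ballI)
  fix v w assume "v \<in> S" "w \<in> S"
  then show "reachable (edges G) S v w"
    using rtranclp_trans[OF reachable_sym[OF assms] assms] by blast
qed

section \<open>Cuts and bonds\<close>

lemma cut_edge_iff:
  assumes "a \<noteq> b"
  shows "{a, b} \<in> cut G S \<longleftrightarrow> {a, b} \<in> edges G \<and> (a \<in> S) \<noteq> (b \<in> S)"
  using assms by (cases "a \<in> S"; cases "b \<in> S") (auto simp: cut_def Int_insert_left)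

lemma simple_edgeE:
  assumes "simple_graph G" "e \<in> edges G"
  obtains a b where "e = {a, b}" "a \<noteq> b" "a \<in> verts G" "b \<in> verts G"
proof -
  have "card e = 2" "e \<subseteq> verts G" using assms by (auto simp: simple_graph_def)
  then show ?thesis using that by (auto simp: card_2_iff)
qed

lemma cut_edgeE:
  assumes "simple_graph G" "e \<in> cut G S"
  obtains a b where "e = {a, b}" "e \<in> edges G" "a \<in> S" "b \<notin> S" "a \<in> verts G" "b \<in> verts G"
proof -
  have e: "e \<in> edges G" using assms by (simp add: cut_def)
  then obtain a b where ab: "e = {a, b}" "a \<noteq> b" "a \<in> verts G" "b \<in> verts G"
    using assms simple_edgeE by metis
  then have "(a \<in> S) \<noteq> (b \<in> S)" using assms cut_edge_iff by metis
  then show ?thesis using that[of a b] that[of b a] ab e by (auto simp: insert_commute)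
qed

section \<open>Components and the bonds they cut off\<close>

definition component :: "'v ugraph \<Rightarrow> 'v set \<Rightarrow> 'v \<Rightarrow> 'v set" where
  "component G X x = {y. reachable (edges G) X x y}"

lemma component_self: "x \<in> component G X x"
  by (simp add: component_def)

lemma component_eq:
  assumes "y \<in> component G X x"
  shows "component G X y = component G X x"
proof -
  have "reachable (edges G) X x y" using assms by (simp add: component_def)
  from rtranclp_trans[OF this] rtranclp_trans[OF reachable_sym[OF this]]
  show ?thesis unfolding component_def by blast
qed

lemma component_subset: "x \<in> X \<Longrightarrow> component G X x \<subseteq> X"
  using reachable_in[of "edges G" X x] by (auto simp: component_def)

lemma component_step:
  assumes "y \<in> component G X x" "{y, z} \<in> edges G" "y \<in> X" "z \<in> X"
  shows "z \<in> component G X x"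
proof -
  have "adjacent_in (edges G) X y z" using assms by (simp add: adjacent_in_def)
  then show ?thesis
    using assms(1) unfolding component_def by (simp add: rtranclp.rtrancl_into_rtrancl)
qed

text \<open>Every vertex visited by a walk from \<open>x\<close> inside \<open>X\<close> is itself
  in the component, so the walk survives the restriction.\<close>

lemma connected_component: "connected_graph (induced G (component G X x))"
proof (rule connected_inducedI)
  fix v assume "v \<in> component G X x"
  then have "reachable (edges G) X x v" by (simp add: component_def)
  then show "reachable (edges G) (component G X x) x v"
  proof (induction rule: rtranclp_induct)
    case (step y z)
    then have "y \<in> component G X x" "z \<in> component G X x"
      by (auto simp: component_def)
    then have "adjacent_in (edges G) (component G X x) y z"
      using step.hyps by (simp add: adjacent_in_def)
    with step.IH show ?case by (rule rtranclp.rtrancl_into_rtrancl)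
  qed simp
qed

text \<open>A component of the complement of \<open>T\<close> has all its outside neighbours in
  \<open>T\<close>. A walk in \<open>G\<close> that leaves the component therefore enters
  \<open>T\<close>, and connectedness of \<open>T\<close> allows the detour through the component to
  be bypassed.\<close>

lemma is_bond_cut_component:
  assumes "connected_graph G" "T \<subseteq> verts G" "T \<noteq> {}"
    and T: "connected_graph (induced G T)" and x: "x \<in> verts G - T"
  shows "is_bond G (cut G (component G (verts G - T) x))"
proof -
  define K where "K = component G (verts G - T) x"
  have K: "K \<subseteq> verts G - T" unfolding K_def using component_subset[OF x] .
  obtain t where t: "t \<in> T" using assms by auto
  \<comment> \<open>Invariant along a walk from \<open>t\<close>: each vertex is in \<open>K\<close>
    or can be reached while avoiding \<open>K\<close>.\<close>
  have "z \<in> K \<or> reachable (edges G) (verts G - K) t z"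
    if "reachable (edges G) (verts G) t z" for z
    using that
  proof (induction rule: rtranclp_induct)
    case (step y z)
    then have yz: "{y, z} \<in> edges G" "y \<in> verts G" "z \<in> verts G"
      by (auto simp: adjacent_in_def)
    show ?case
    proof (cases "z \<in> K")
      case zK: False
      show ?thesis
      proof (cases "y \<in> K")
        case True
        have "z \<in> T"
        proof (rule ccontr)
          assume zT: "z \<notin> T"
          have "z \<in> K"
            unfolding K_def by (rule component_step[of y]) (use zT True yz K K_def in auto)
          with zK show False ..
        qed
        then have "reachable (edges G) T t z" using T t by (simp add: connected_induced_iff)
        then have "reachable (edges G) (verts G - K) t z"
          by (rule reachable_mono) (use K assms in auto)
        then show ?thesis ..
      next
        case False
        then have "adjacent_in (edges G) (verts G - K) y z" using yz zK by (simp add: adjacent_in_def)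
        moreover have "reachable (edges G) (verts G - K) t y" using False step.IH by simp
        ultimately have "reachable (edges G) (verts G - K) t z"
          by (rule rtranclp.rtrancl_into_rtrancl[rotated])
        then show ?thesis ..
      qed
    qed simp
  qed simp
  then have "reachable (edges G) (verts G - K) t z" if "z \<in> verts G - K" for z
    using that assms t by (auto simp: connected_graph_iff_reachable)
  then have "connected_graph (induced G (verts G - K))" by (rule connected_inducedI)
  moreover have "connected_graph (induced G K)" unfolding K_def by (rule connected_component)
  ultimately show ?thesis using K unfolding is_bond_def K_def by blast
qed

text \<open>The cut around a connected set is the disjoint union of the bonds around the components
  of its complement.\<close>
lemma sum_cut_connected_eq_0:
  fixes w :: "'v set \<Rightarrow> real"
  assumes "simple_graph G" "connected_graph G" "T \<subseteq> verts G" "T \<noteq> {}"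
    and "connected_graph (induced G T)"
    and w: "\<And>d. is_bond G d \<Longrightarrow> sum w d = 0"
  shows "sum w (cut G T) = 0"
proof -
  let ?K = "component G (verts G - T)"
  let ?\<K> = "?K ` (verts G - T)"
  have fin: "finite (verts G)" using assms(1) by (simp add: simple_graph_def)
  then have "finite (Pow (verts G))" by simp
  moreover have "edges G \<subseteq> Pow (verts G)" using assms(1) by (auto simp: simple_graph_def)
  ultimately have finE: "finite (edges G)" using finite_subset by blast
  \<comment> \<open>A cut edge of a component has its outer end in \<open>T\<close>, and its inner
    end determines the component. The first fact places it in the cut of \<open>T\<close>, the
    second makes the cuts of different components disjoint.\<close>
  have K: "\<exists>y z. e = {y, z} \<and> y \<in> K \<and> z \<in> T \<and> y \<notin> T \<and> K = ?K y"
    if KK: "K \<in> ?\<K>" and eK: "e \<in> cut G K" for e K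
  proof -
    obtain x where x: "x \<in> verts G - T" "K = ?K x" using KK by auto
    obtain y z where yz: "e = {y, z}" "e \<in> edges G" "y \<in> K" "z \<notin> K" "y \<in> verts G" "z \<in> verts G"
      using cut_edgeE[OF assms(1) eK] by metis
    have y: "y \<in> verts G - T" using yz x component_subset[OF x(1)] by auto
    have "z \<in> T"
    proof (rule ccontr)
      assume zT: "z \<notin> T"
      have "z \<in> K"
        unfolding x(2) by (rule component_step[of y]) (use zT yz y x(2) in auto)
      with yz(4) show False ..
    qed
    moreover have "?K y = K" using yz(3) x(2) component_eq by metis
    ultimately show ?thesis using yz y by auto
  qed
  have "cut G T = (\<Union>K\<in>?\<K>. cut G K)"
  proof (intro equalityI subsetI)
    fix e assume "e \<in> cut G T"
    then obtain z y where yz: "e = {z, y}" "e \<in> edges G" "z \<in> T" "y \<notin> T" "z \<in> verts G" "y \<in> verts G"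
      using cut_edgeE[OF assms(1)] by metis
    then have "z \<notin> ?K y" using component_subset[of y "verts G - T" G] by auto
    then have "e \<in> cut G (?K y)"
      using yz component_self[of y G] cut_edge_iff[of z y] by auto
    then show "e \<in> (\<Union>K\<in>?\<K>. cut G K)" using yz by auto
  next
    fix e assume "e \<in> (\<Union>K\<in>?\<K>. cut G K)"
    then obtain K where eK: "K \<in> ?\<K>" "e \<in> cut G K" by blast
    then obtain y z where "e = {y, z}" "z \<in> T" "y \<notin> T" using K by metis
    then show "e \<in> cut G T"
      using eK(2) cut_edge_iff[of y z G T] by (auto simp: cut_def)
  qed
  moreover have "sum w (\<Union>K\<in>?\<K>. cut G K) = (\<Sum>K\<in>?\<K>. sum w (cut G K))"
  proof (rule sum.UNION_disjoint)
    show "\<forall>K\<in>?\<K>. finite (cut G K)" using finE by (auto simp: cut_def)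
    show "\<forall>K\<in>?\<K>. \<forall>L\<in>?\<K>. K \<noteq> L \<longrightarrow> cut G K \<inter> cut G L = {}"
    proof (intro ballI impI, rule ccontr)
      fix K L assume KL: "K \<in> ?\<K>" "L \<in> ?\<K>" "K \<noteq> L" "cut G K \<inter> cut G L \<noteq> {}"
      then obtain e where e: "e \<in> cut G K" "e \<in> cut G L" by auto
      obtain y z where "e = {y, z}" "z \<in> T" "y \<notin> T" "K = ?K y" using K[OF KL(1) e(1)] by blast
      moreover obtain y' z' where "e = {y', z'}" "z' \<in> T" "y' \<notin> T" "L = ?K y'"
        using K[OF KL(2) e(2)] by blast
      ultimately have "K = L" by (metis doubleton_eq_iff)
      with KL(3) show False ..
    qed
  qed (use fin in simp)
  moreover have "(\<Sum>K\<in>?\<K>. sum w (cut G K)) = 0"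
    by (rule sum.neutral) (use is_bond_cut_component[OF assms(2-5)] w in auto)
  ultimately show ?thesis by simp
qed

text \<open>The bonds span the edge space, since
  \<open>\<delta>({u}) + \<delta>({v}) - \<delta>({u, v}) = 2 \<chi>\<^sub>u\<^sub>v\<close> for every edge \<open>uv\<close>.\<close>
lemma eq_0_if_sum_bonds_eq_0:
  fixes w :: "'v set \<Rightarrow> real"
  assumes "simple_graph G" "connected_graph G" "e \<in> edges G"
    and w: "\<And>d. is_bond G d \<Longrightarrow> sum w d = 0"
  shows "w e = 0"
proof -
  obtain u v where uv: "e = {u, v}" "u \<noteq> v" "u \<in> verts G" "v \<in> verts G"
    using simple_edgeE[OF assms(1,3)] .
  have fin: "finite (edges G)"
    using assms(1) finite_subset[of "edges G" "Pow (verts G)"] by (auto simp: simple_graph_def)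
  have conn: "connected_graph (induced G {u})" "connected_graph (induced G {v})"
    by (auto simp: connected_induced_iff)
  have "reachable (edges G) {u, v} u z" if "z \<in> {u, v}" for z
    using that assms(3) uv(1) by (auto simp: adjacent_in_def intro: r_into_rtranclp)
  then have conn2: "connected_graph (induced G {u, v})" by (rule connected_inducedI)
  note cut0 = sum_cut_connected_eq_0[OF assms(1,2) _ _ _ w]
  have cuts: "sum w (cut G {u}) = 0" "sum w (cut G {v}) = 0" "sum w (cut G {u, v}) = 0"
    using cut0[OF _ _ conn(1)] cut0[OF _ _ conn(2)] cut0[OF _ _ conn2] uv by auto
  \<comment> \<open>As sums over all edges with indicators, the three cuts can be compared edge by
    edge.\<close>
  have ind: "sum w (cut G S) = (\<Sum>f\<in>edges G. if f \<in> cut G S then w f else 0)" for S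
    unfolding sum.inter_restrict[OF fin, symmetric] by (rule sum.cong) (auto simp: cut_def)
  have "0 = sum w (cut G {u}) + sum w (cut G {v}) - sum w (cut G {u, v})" using cuts by simp
  also have "\<dots> = (\<Sum>f\<in>edges G. if f = e then 2 * w f else 0)"
    unfolding ind sum.distrib[symmetric] sum_subtractf[symmetric]
  proof (rule sum.cong[OF refl])
    fix f assume f: "f \<in> edges G"
    obtain a b where ab: "f = {a, b}" "a \<noteq> b" using simple_edgeE[OF assms(1) f] by metis
    show "(if f \<in> cut G {u} then w f else 0) + (if f \<in> cut G {v} then w f else 0) -
        (if f \<in> cut G {u, v} then w f else 0) = (if f = e then 2 * w f else 0)"
      using f uv(2) unfolding ab(1) uv(1) cut_edge_iff[OF ab(2)]
      by (auto simp: doubleton_eq_iff ab(2))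
  qed
  also have "\<dots> = 2 * w e" using fin assms(3) by simp
  finally show ?thesis by simp
qed

section \<open>Cuts along a cycle\<close>

lemma exists_change:
  fixes t :: "nat \<Rightarrow> bool"
  assumes "i < j" "t i \<noteq> t j"
  shows "\<exists>d. i \<le> d \<and> d < j \<and> t d \<noteq> t (Suc d)"
  using assms
proof (induction j)
  case (Suc j)
  then show ?case by (metis less_Suc_eq le_refl less_imp_le)
qed simp

text \<open>Each change flips the value, so the parity of their number records whether the two ends
  agree.\<close>

lemma even_card_changes:
  fixes t :: "nat \<Rightarrow> bool"
  shows "even (card {i. i < m \<and> t i \<noteq> t (Suc i)}) \<longleftrightarrow> t 0 = t m"
proof (induction m)
  case (Suc m)
  have "{i. i < Suc m \<and> t i \<noteq> t (Suc i)} =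
    (if t m \<noteq> t (Suc m) then insert m {i. i < m \<and> t i \<noteq> t (Suc i)}
     else {i. i < m \<and> t i \<noteq> t (Suc i)})"
    by (auto simp: less_Suc_eq)
  then show ?case using Suc by auto
qed simp

text \<open>Take \<open>d\<close> to be the last change before \<open>m\<close>: the value is
  constant from \<open>Suc d\<close> to \<open>m\<close>, and all other changes come before
  \<open>d\<close>. Iterating this extracts an alternating sequence of positions from the
  right.\<close>

lemma exists_last_change:
  fixes t :: "nat \<Rightarrow> bool"
  assumes "Suc k \<le> card {i. i < m \<and> t i \<noteq> t (Suc i)}"
  shows "\<exists>d<m. t d \<noteq> t (Suc d) \<and> t (Suc d) = t m \<and> k \<le> card {i. i < d \<and> t i \<noteq> t (Suc i)}"
  using assms
proof (induction m)
  case (Suc m)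
  have *: "{i. i < Suc m \<and> t i \<noteq> t (Suc i)} =
    (if t m \<noteq> t (Suc m) then insert m {i. i < m \<and> t i \<noteq> t (Suc i)}
     else {i. i < m \<and> t i \<noteq> t (Suc i)})"
    by (auto simp: less_Suc_eq)
  show ?case
  proof (cases "t m = t (Suc m)")
    case True
    then show ?thesis using Suc * by (auto simp: less_Suc_eq)
  next
    case False
    then have "k \<le> card {i. i < m \<and> t i \<noteq> t (Suc i)}" using Suc.prems * by auto
    then show ?thesis using False by blast
  qed
qed simp

text \<open>Reducing the index makes position \<open>length vs\<close> the same as position 0, so
  the closing edge of the cycle is a change like any other.\<close>

definition side :: "'v set \<Rightarrow> 'v list \<Rightarrow> nat \<Rightarrow> bool" where
  "side S vs i \<longleftrightarrow> vs ! (i mod length vs) \<in> S"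

lemma cycle_adjacent_positions:
  assumes "cycle_order C vs" "{vs ! x, vs ! y} \<in> edges C" "x < length vs" "y < length vs"
  shows "y = Suc x mod length vs \<or> x = Suc y mod length vs"
proof -
  obtain i where i: "i < length vs" "{vs ! x, vs ! y} = {vs ! i, vs ! (Suc i mod length vs)}"
    using assms by (auto simp: cycle_order_def)
  moreover have "Suc i mod length vs < length vs" using i by (intro mod_less_divisor) auto
  ultimately show ?thesis
    using assms by (auto simp: doubleton_eq_iff cycle_order_def nth_eq_iff_index_eq)
qed

text \<open>The cycle edge leaving position \<open>i\<close> is cut exactly when the side changes
  there, which reduces cuts on the cycle to changes in a Boolean sequence.\<close>

lemma card_cycle_cut:
  assumes "cycle_order C vs" "edges C \<subseteq> edges G"
  shows "card (edges C \<inter> cut G S) = card {i. i < length vs \<and> side S vs i \<noteq> side S vs (Suc i)}"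
proof -
  let ?n = "length vs"
  let ?e = "\<lambda>i. {vs ! i, vs ! (Suc i mod ?n)}"
  have n: "3 \<le> ?n" "distinct vs" and E: "edges C = ?e ` {..<?n}"
    using assms(1) by (auto simp: cycle_order_def)
  have mod: "Suc i mod ?n = (if Suc i = ?n then 0 else Suc i)" if "i < ?n" for i
    using that by auto
  have lt: "Suc i mod ?n < ?n" for i using n by (intro mod_less_divisor) auto
  have inj: "inj_on ?e {..<?n}"
  proof (rule inj_onI)
    fix i j assume ij: "i \<in> {..<?n}" "j \<in> {..<?n}" "?e i = ?e j"
    \<comment> \<open>The second alternative would be a cycle with two vertices; length at least 3
      rules it out.\<close>
    then have "i = j \<or> (i = Suc j mod ?n \<and> Suc i mod ?n = j)"
      using n lt by (auto simp: doubleton_eq_iff nth_eq_iff_index_eq)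
    then show "i = j" using ij n by (auto simp: mod split: if_splits)
  qed
  have "edges C \<inter> cut G S = ?e ` {i. i < ?n \<and> side S vs i \<noteq> side S vs (Suc i)}"
  proof -
    have "?e i \<in> cut G S \<longleftrightarrow> side S vs i \<noteq> side S vs (Suc i)" if "i < ?n" for i
    proof -
      have "i \<noteq> Suc i mod ?n" using that n by (auto simp: mod)
      then have "vs ! i \<noteq> vs ! (Suc i mod ?n)" using that n lt by (simp add: nth_eq_iff_index_eq)
      moreover have "?e i \<in> edges G" using E assms(2) that by auto
      ultimately show ?thesis using that by (auto simp: cut_edge_iff side_def)
    qed
    then show ?thesis unfolding E by auto
  qed
  then show ?thesis
    using card_image[OF inj_on_subset[OF inj]] by (simp add: subset_iff)
qed

text \<open>Going once around the cycle ends on the side where it began.\<close>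

lemma even_card_cycle_cut:
  assumes "cycle_order C vs" "edges C \<subseteq> edges G"
  shows "even (card (edges C \<inter> cut G S))"
  unfolding card_cycle_cut[OF assms] even_card_changes by (simp add: side_def)

section \<open>Interleaved cycles\<close>

text \<open>A bond separating the two crossing paths of an interleaved cycle meets the cycle between
  any two consecutive end vertices.\<close>
lemma interleaved_bond:
  assumes "simple_graph G" "connected_graph G" "subgraph C G" "interleaved G C"
  shows "\<exists>d. is_bond G d \<and> card (edges C \<inter> d) > 2"
proof -
  obtain vs i j k l p q where vs: "cycle_order C vs" "i < j" "j < k" "k < l" "l < length vs"
    and p: "path_between (delete_edges G (edges C)) (vs ! i) p (vs ! k)"
    and q: "path_between (delete_edges G (edges C)) (vs ! j) q (vs ! l)"
    and pq: "set p \<inter> set q = {}"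
    using assms(4) unfolding interleaved_def by blast
  have sub: "edges (delete_edges G (edges C)) \<subseteq> edges G" by (auto simp: delete_edges_def)
  have pV: "set p \<subseteq> verts G" "vs ! i \<in> set p" "vs ! k \<in> set p"
    using p hd_in_set[of p] last_in_set[of p] by (auto simp: path_between_def delete_edges_def)
  have qV: "set q \<subseteq> verts G" "vs ! j \<in> set q" "vs ! l \<in> set q"
    using q hd_in_set[of q] last_in_set[of q] by (auto simp: path_between_def delete_edges_def)
  \<comment> \<open>Removing the first path leaves the second one inside a single component; that
    component supplies the bond.\<close>
  let ?K = "component G (verts G - set p) (vs ! j)"
  have "connected_graph (induced G (set p))"
    by (rule connected_inducedI) (use path_between_reachable[OF p sub order_refl] in auto)
  moreover have j: "vs ! j \<in> verts G - set p" using qV pq by auto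
  ultimately have bond: "is_bond G (cut G ?K)"
    using is_bond_cut_component assms(2) pV by (metis empty_iff)
  have "reachable (edges G) (verts G - set p) (vs ! j) (vs ! l)"
    by (rule path_between_reachable[OF q sub]) (use qV pq in auto)
  then have "vs ! l \<in> ?K" "vs ! j \<in> ?K" by (auto simp: component_def)
  moreover have "vs ! i \<notin> ?K" "vs ! k \<notin> ?K" using component_subset[OF j] pV by blast+
  ultimately have "\<not> side ?K vs i" "side ?K vs j" "\<not> side ?K vs k" "side ?K vs l"
    using vs by (simp_all add: side_def)
  \<comment> \<open>The sides alternate at \<open>i\<close>, \<open>j\<close>, \<open>k\<close>,
    \<open>l\<close>, so each of the three gaps contains a change; the gaps are disjoint, so these
    changes are distinct.\<close>
  then obtain a b c where abc: "i \<le> a" "a < j" "j \<le> b" "b < k" "k \<le> c" "c < l"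
    "side ?K vs a \<noteq> side ?K vs (Suc a)" "side ?K vs b \<noteq> side ?K vs (Suc b)"
    "side ?K vs c \<noteq> side ?K vs (Suc c)"
    using exists_change[OF vs(2), of "side ?K vs"] exists_change[OF vs(3), of "side ?K vs"]
      exists_change[OF vs(4), of "side ?K vs"] by auto
  then have "{a, b, c} \<subseteq> {i. i < length vs \<and> side ?K vs i \<noteq> side ?K vs (Suc i)}"
    using vs by auto
  then have "card {a, b, c} \<le> card {i. i < length vs \<and> side ?K vs i \<noteq> side ?K vs (Suc i)}"
    by (intro card_mono) auto
  then have "card (edges C \<inter> cut G ?K) > 2"
    using card_cycle_cut[OF vs(1)] assms(3) abc by (simp add: subgraph_def)
  then show ?thesis using bond by blast
qed

section \<open>From bonds with many cycle edges to crossing paths\<close>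

lemma path_between_rev:
  assumes "path_between H u p v"
  shows "path_between H v (rev p) u"
  using assms by (auto simp: path_between_def hd_rev last_rev successively_rev insert_commute)

lemma interleavedI:
  assumes "cycle_order C vs" "i < j" "j < k" "k < l" "l < length vs"
    and "path_between (delete_edges G (edges C)) (vs ! i) p (vs ! k)"
    and "path_between (delete_edges G (edges C)) (vs ! j) q (vs ! l)"
    and "set p \<inter> set q = {}"
  shows "interleaved G C"
  unfolding interleaved_def
  by (rule exI[of _ vs], rule exI[of _ i], rule exI[of _ j], rule exI[of _ k], rule exI[of _ l],
      rule exI[of _ p], rule exI[of _ q]) (use assms in simp)

text \<open>Two chords cross when exactly one end of the second lies between the ends of the first.
  If \<open>d\<close> comes first, the second path is reversed and takes the leading role.\<close>

lemma interleavedI_crossing: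
  assumes vs: "cycle_order C vs" and "a < c" "c < b" "b < length vs"
    and "d < a \<or> b < d" "d < length vs"
    and p: "path_between (delete_edges G (edges C)) (vs ! a) p (vs ! b)"
    and q: "path_between (delete_edges G (edges C)) (vs ! c) q (vs ! d)"
    and "set p \<inter> set q = {}"
  shows "interleaved G C"
proof (cases "d < a")
  case True
  show ?thesis
    by (rule interleavedI[OF vs _ _ _ _ path_between_rev[OF q] p]) (use assms True in auto)
next
  case False
  show ?thesis
    by (rule interleavedI[OF vs _ _ _ _ p q]) (use assms False in auto)
qed

text \<open>Among the vertices of \<open>T\<close> those reachable off the cycle from the positions inside \<open>(a, b)\<close>
  would otherwise be closed under adjacency, because cycle edges cannot jump over \<open>a\<close> or \<open>b\<close>.\<close>
lemma path_off_cycle: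
  assumes vs: "cycle_order C vs" and T: "connected_graph (induced G T)" "T \<subseteq> verts G"
    and ab: "a < b" "b < length vs" "vs ! a \<notin> T" "vs ! b \<notin> T"
    and m: "a < m" "m < b" "vs ! m \<in> T"
    and m': "m' < a \<or> b < m'" "m' < length vs" "vs ! m' \<in> T"
  shows "\<exists>c d p. a < c \<and> c < b \<and> (d < a \<or> b < d) \<and> d < length vs \<and> set p \<subseteq> T \<and>
    path_between (delete_edges G (edges C)) (vs ! c) p (vs ! d)"
proof -
  let ?n = "length vs"
  let ?R = "reachable (edges G - edges C) T"
  have "\<exists>c d. a < c \<and> c < b \<and> (d < a \<or> b < d) \<and> d < ?n \<and> vs ! c \<in> T \<and> ?R (vs ! c) (vs ! d)"
  proof (rule ccontr)
    assume no: "\<not> ?thesis"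
    \<comment> \<open>Invariant for a walk in \<open>T\<close>, which may use cycle edges: its
      current vertex is reachable off the cycle from some position inside
      \<open>(a, b)\<close>.\<close>
    have "\<exists>c. a < c \<and> c < b \<and> vs ! c \<in> T \<and> ?R (vs ! c) y"
      if "reachable (edges G) T (vs ! m) y" for y
      using that
    proof (induction rule: rtranclp_induct)
      case base
      then show ?case using m by blast
    next
      case (step y z)
      then obtain c where c: "a < c" "c < b" "vs ! c \<in> T" "?R (vs ! c) y" by blast
      have yz: "{y, z} \<in> edges G" "y \<in> T" "z \<in> T" using step.hyps by (auto simp: adjacent_in_def)
      show ?case
      proof (cases "{y, z} \<in> edges C")
        case False
        then have "adjacent_in (edges G - edges C) T y z" using yz by (simp add: adjacent_in_def)
        then show ?thesis using c rtranclp.rtrancl_into_rtrancl by metis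
      next
        case True
        have "edges C \<subseteq> Pow (set vs)"
        proof -
          have "Suc i mod ?n < ?n" for i using ab by (intro mod_less_divisor) auto
          then show ?thesis using vs by (auto simp: cycle_order_def)
        qed
        then have "y \<in> set vs" "z \<in> set vs" using True by auto
        then obtain s r where sr: "s < ?n" "y = vs ! s" "r < ?n" "z = vs ! r"
          by (metis in_set_conv_nth)
        \<comment> \<open>A position outside would provide the path assumed not to exist, and
          \<open>a\<close> and \<open>b\<close> themselves are not in \<open>T\<close>.\<close>
        then have "\<not> (s < a \<or> b < s)" using no c by blast
        then have s: "a < s" "s < b" using ab yz(2) sr by (auto simp: not_less le_less)
        have "r \<noteq> a" "r \<noteq> b" using ab yz(3) sr by auto
        moreover have "r = Suc s mod ?n \<or> s = Suc r mod ?n"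
          using cycle_adjacent_positions[OF vs] True sr by blast
        \<comment> \<open>The closing edge joins the last position to 0, and neither lies strictly
          between \<open>a\<close> and \<open>b\<close>, so \<open>s\<close> and \<open>r\<close>
          differ by one.\<close>
        then have "r = Suc s \<or> s = Suc r"
        proof
          assume "r = Suc s mod ?n"
          then show ?thesis using s ab by simp
        next
          assume "s = Suc r mod ?n"
          then show ?thesis using s sr by (cases "Suc r = ?n") auto
        qed
        ultimately have "a < r" "r < b" using s by auto
        \<comment> \<open>Here \<open>z\<close> is itself at an inside position and restarts the
          invariant with a trivial path.\<close>
        then show ?thesis using sr yz by blast
      qed
    qed
    moreover have "reachable (edges G) T (vs ! m) (vs ! m')"
      using T(1) m m' by (simp add: connected_induced_iff)
    ultimately obtain c where "a < c" "c < b" "vs ! c \<in> T" "?R (vs ! c) (vs ! m')"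
      by blast
    then show False using no m' by blast
  qed
  then obtain c d where cd: "a < c" "c < b" "d < a \<or> b < d" "d < ?n" "vs ! c \<in> T"
    "?R (vs ! c) (vs ! d)" by blast
  obtain p where "p \<noteq> []" "hd p = vs ! c" "last p = vs ! d" "distinct p" "set p \<subseteq> T"
    "successively (\<lambda>a b. {a, b} \<in> edges G - edges C) p"
    using reachable_path[OF cd(6,5)] by blast
  then have "path_between (delete_edges G (edges C)) (vs ! c) p (vs ! d)"
    using T(2) by (auto simp: path_between_def delete_edges_def)
  then show ?thesis using cd \<open>set p \<subseteq> T\<close> by blast
qed

text \<open>A first use of \<open>path_off_cycle\<close> gives a path in \<open>S\<close> from
  between \<open>j\<close> and \<open>l\<close> to outside that range. Its ends then separate
  \<open>j\<close> from \<open>l\<close> on the cycle, so a second use gives a path in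
  \<open>T\<close> crossing it; disjointness of \<open>S\<close> and \<open>T\<close> keeps the
  paths apart.\<close>

lemma interleaved_if_alternating:
  assumes vs: "cycle_order C vs"
    and S: "connected_graph (induced G S)" "S \<subseteq> verts G"
    and T: "connected_graph (induced G T)" "T \<subseteq> verts G" and "S \<inter> T = {}"
    and pos: "i < j" "j < k" "k < l" "l < length vs"
    and mem: "vs ! i \<in> S" "vs ! j \<in> T" "vs ! k \<in> S" "vs ! l \<in> T"
  shows "interleaved G C"
proof -
  let ?H = "delete_edges G (edges C)"
  have "\<exists>c d p. j < c \<and> c < l \<and> (d < j \<or> l < d) \<and> d < length vs \<and> set p \<subseteq> S \<and>
    path_between ?H (vs ! c) p (vs ! d)"
    by (rule path_off_cycle[OF vs S, where m = k and m' = i]) (use assms in auto)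
  then obtain c d p where cd: "j < c" "c < l" "d < j \<or> l < d" "d < length vs"
    and pS: "set p \<subseteq> S" and p: "path_between ?H (vs ! c) p (vs ! d)" by blast
  have ends: "vs ! c \<in> S" "vs ! d \<in> S" using p pS hd_in_set[of p] last_in_set[of p]
    by (auto simp: path_between_def)
  show ?thesis
  proof (cases "d < j")
    case True
    have "\<exists>x y q. d < x \<and> x < c \<and> (y < d \<or> c < y) \<and> y < length vs \<and> set q \<subseteq> T \<and>
      path_between ?H (vs ! x) q (vs ! y)"
      by (rule path_off_cycle[OF vs T, where m = j and m' = l]) (use assms cd ends True in auto)
    then obtain x y q where "d < x" "x < c" "y < d \<or> c < y" "y < length vs" "set q \<subseteq> T"
      "path_between ?H (vs ! x) q (vs ! y)" by blast
    then show ?thesis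
      using interleavedI_crossing[OF vs _ _ _ _ _ path_between_rev[OF p], of x y q] cd pS
        \<open>S \<inter> T = {}\<close> pos by fastforce
  next
    case False
    have "\<exists>x y q. c < x \<and> x < d \<and> (y < c \<or> d < y) \<and> y < length vs \<and> set q \<subseteq> T \<and>
      path_between ?H (vs ! x) q (vs ! y)"
      by (rule path_off_cycle[OF vs T, where m = l and m' = j]) (use assms cd ends False in auto)
    then obtain x y q where "c < x" "x < d" "y < c \<or> d < y" "y < length vs" "set q \<subseteq> T"
      "path_between ?H (vs ! x) q (vs ! y)" by blast
    then show ?thesis
      using interleavedI_crossing[OF vs _ _ _ _ _ p, of x y q] cd pS \<open>S \<inter> T = {}\<close> by fastforce
  qed
qed

text \<open>More than two cut edges give four positions whose vertices alternate between the two
  connected sides of the bond, which makes the cycle interleaved.\<close>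

lemma card_bond_non_interleaved:
  assumes "non_interleaved_cycle G C" "is_bond G d"
  shows "card (edges C \<inter> d) \<le> 2"
proof (rule ccontr)
  assume card: "\<not> card (edges C \<inter> d) \<le> 2"
  obtain S where S: "S \<subseteq> verts G" "d = cut G S" "connected_graph (induced G S)"
    "connected_graph (induced G (verts G - S))" using assms(2) by (auto simp: is_bond_def)
  obtain vs where vs: "cycle_order C vs" and sub: "subgraph C G"
    using assms(1) by (auto simp: non_interleaved_cycle_def cycle_in_def)
  let ?t = "side S vs"
  have *: "Suc (Suc (Suc 0)) \<le> card {i. i < length vs \<and> ?t i \<noteq> ?t (Suc i)}"
    using card card_cycle_cut[OF vs, of G S] sub S(2) by (simp add: subgraph_def)
  obtain c where c: "c < length vs" "?t c \<noteq> ?t (Suc c)" "?t (Suc c) = ?t (length vs)"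
    "Suc (Suc 0) \<le> card {i. i < c \<and> ?t i \<noteq> ?t (Suc i)}"
    using exists_last_change[OF *] by blast
  obtain b where b: "b < c" "?t b \<noteq> ?t (Suc b)" "?t (Suc b) = ?t c"
    "Suc 0 \<le> card {i. i < b \<and> ?t i \<noteq> ?t (Suc i)}"
    using exists_last_change[OF c(4)] by blast
  obtain a where a: "a < b" "?t a \<noteq> ?t (Suc a)" "?t (Suc a) = ?t b"
    using exists_last_change[OF b(4)] by blast
  \<comment> \<open>Wrapping around compares \<open>c\<close> with position 0, which becomes the
    fourth alternating position.\<close>
  have "?t (length vs) = ?t 0" by (simp add: side_def)
  then have t: "?t 0 \<noteq> ?t a" "?t a \<noteq> ?t b" "?t b \<noteq> ?t c" using a b c by auto
  then have "0 < a" by (cases a) auto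
  have "set vs \<subseteq> verts G" using vs sub by (auto simp: cycle_order_def subgraph_def)
  then have V: "vs ! x \<in> verts G" if "x < length vs" for x using that by auto
  have mem: "?t x \<longleftrightarrow> vs ! x \<in> S" if "x < length vs" for x using that by (simp add: side_def)
  have lt: "0 < length vs" "a < length vs" "b < length vs" "c < length vs" using a b c by auto
  have "interleaved G C"
  proof (cases "?t 0")
    case True
    then show ?thesis
      by (intro interleaved_if_alternating[OF vs S(3,1,4) _ _ \<open>0 < a\<close> a(1) b(1) c(1)])
        (use t lt V mem in auto)
  next
    case False
    then show ?thesis
      by (intro interleaved_if_alternating[OF vs S(4) _ S(3,1) _ \<open>0 < a\<close> a(1) b(1) c(1)])
        (use t lt V mem in auto)
  qed
  then show False using assms(1) by (simp add: non_interleaved_cycle_def)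
qed

section \<open>The facet\<close>

lemma sum_incidence_vector:
  fixes d F :: "('v::finite) set set"
  shows "(\<Sum>e\<in>F. incidence_vector d $ e) = real (card (F \<inter> d))"
  by (simp add: incidence_vector_def sum.If_cases)

text \<open>The facet and the origin together affinely span the polytope.\<close>
lemma linear_eq_0_if_eq_0_on_facet:
  fixes f g :: "'a::euclidean_space \<Rightarrow> real"
  assumes f: "defines_facet P f b" and "0 \<in> P" "b \<noteq> 0"
    and g: "linear g" and F: "\<And>x. x \<in> P \<Longrightarrow> f x = b \<Longrightarrow> g x = 0" and x: "x \<in> P"
  shows "g x = 0"
proof -
  let ?F = "{x \<in> P. f x = b}"
  have lin: "linear f" and facet: "?F facet_of P" using f by (auto simp: defines_facet_def)
  have "affine {x. f x = b}"
    by (simp add: affine_def linear_add[OF lin] linear_scale[OF lin] flip: distrib_right)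
  then have "affine hull ?F \<subseteq> {x. f x = b}" by (intro hull_minimal) auto
  then have "0 \<notin> affine hull ?F" using linear_0[OF lin] \<open>b \<noteq> 0\<close> by auto
  \<comment> \<open>A facet has dimension one less than \<open>P\<close>, and adjoining a point off
    its affine hull makes up the difference.\<close>
  then have "aff_dim P \<le> aff_dim (insert 0 ?F)"
    using facet by (simp add: aff_dim_insert facet_of_def)
  moreover have "insert 0 ?F \<subseteq> P" using \<open>0 \<in> P\<close> by auto
  then have "aff_dim (insert 0 ?F) \<le> aff_dim P" "affine hull (insert 0 ?F) \<subseteq> affine hull P"
    by (rule aff_dim_subset, rule hull_mono)
  ultimately have "affine hull (insert 0 ?F) = affine hull P"
    by (intro affine_dim_equal) auto
  then have "x \<in> affine hull (insert 0 ?F)" using x hull_inc by metis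
  also have "\<dots> = span (insert 0 ?F)" by (intro affine_hull_span_0 hull_inc) simp
  finally have "x \<in> span ?F" by (simp add: span_insert_0)
  then show ?thesis
    by (rule linear_eq_0_on_span[OF g, rotated]) (use F in auto)
qed

text \<open>A face of the hull of finitely many points is the hull of some of them, so vanishing
  needs to be checked only at the bonds on the face.\<close>

lemma linear_eq_0_on_bond_face:
  fixes G :: "('v::finite) ugraph"
  assumes f: "defines_facet (bond_polytope G) f b" and g: "linear g"
    and bonds: "\<And>d. is_bond G d \<Longrightarrow> f (incidence_vector d) = b \<Longrightarrow> g (incidence_vector d) = 0"
    and x: "x \<in> bond_polytope G" "f x = b"
  shows "g x = (0::real)"
proof -
  let ?B = "{incidence_vector d | d. is_bond G d}" and ?F = "{x \<in> bond_polytope G. f x = b}"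
  have "finite ?B"
    by (rule finite_subset[of _ "range incidence_vector"]) auto
  moreover have "?F face_of convex hull ?B"
    using f by (simp add: defines_facet_def facet_of_def bond_polytope_def)
  ultimately obtain B where B: "B \<subseteq> ?B" "?F = convex hull B"
    using face_of_convex_hull_subset[OF finite_imp_compact] by blast
  have "x \<in> span B"
    using x B(2) convex_hull_subset_span[of B] by blast
  moreover have "g y = 0" if "y \<in> B" for y
  proof -
    have "y \<in> ?F" unfolding B(2) using that by (rule hull_inc)
    then show ?thesis using that B(1) bonds by auto
  qed
  ultimately show ?thesis using linear_eq_0_on_span[OF g, of B x] by blast
qed

theorem theorem6p7:
  fixes G C :: "('v::finite) ugraph"
  assumes "simple_graph G"
    and "connected_graph G"
    and "cycle_in G C"
    and "defines_facet (bond_polytope G) (\<lambda>x. \<Sum>e\<in>edges C. x $ e) 2"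
  shows "maximal_non_interleaved G C"
proof -
  have P: "incidence_vector d \<in> bond_polytope G" if "is_bond G d" for d
    unfolding bond_polytope_def using that by (intro hull_inc) blast
  \<comment> \<open>Validity of the inequality, evaluated at incidence vectors of bonds.\<close>
  have le2: "card (edges C \<inter> d) \<le> 2" if "is_bond G d" for d
    using assms(4) P[OF that] by (auto simp: defines_facet_def sum_incidence_vector)
  have sub: "subgraph C G" using assms(3) by (simp add: cycle_in_def)
  have "\<not> interleaved G C"
    using interleaved_bond[OF assms(1,2) sub] le2 by (metis not_less)
  then have non: "non_interleaved_cycle G C" using assms(3) by (simp add: non_interleaved_cycle_def)
  have False if C': "non_interleaved_cycle G C'" and one: "card (edges C - edges C') = 1" for C'
  proof -
    obtain vs where vs: "cycle_order C' vs" and sub': "edges C' \<subseteq> edges G"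
      using C' by (auto simp: non_interleaved_cycle_def cycle_in_def subgraph_def)
    define g :: "real ^ ('v set) \<Rightarrow> real"
      where "g = (\<lambda>x. (\<Sum>e\<in>edges C. x $ e) - (\<Sum>e\<in>edges C'. x $ e))"
    have lin: "linear g"
      unfolding g_def
      by (rule linearI) (simp_all add: sum.distrib sum_distrib_left algebra_simps)
    have tight: "card (edges C' \<inter> d) = 2" if d: "is_bond G d" "card (edges C \<inter> d) = 2" for d
    proof -
      have "edges C \<inter> d \<subseteq> (edges C' \<inter> d) \<union> (edges C - edges C')" by auto
      then have "card (edges C \<inter> d) \<le> card ((edges C' \<inter> d) \<union> (edges C - edges C'))"
        by (intro card_mono) auto
      also have "\<dots> \<le> card (edges C' \<inter> d) + 1"
        using card_Un_le[of "edges C' \<inter> d" "edges C - edges C'"] one by simp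
      finally have "1 \<le> card (edges C' \<inter> d)" using d by simp
      moreover have "even (card (edges C' \<inter> d))"
        using even_card_cycle_cut[OF vs sub'] d by (auto simp: is_bond_def)
      moreover have "card (edges C' \<inter> d) \<le> 2" using card_bond_non_interleaved[OF C' d(1)] .
      ultimately show ?thesis by presburger
    qed
    have face: "g x = 0" if "x \<in> bond_polytope G" "(\<Sum>e\<in>edges C. x $ e) = 2" for x
      by (rule linear_eq_0_on_bond_face[OF assms(4) lin _ that])
        (use tight in \<open>auto simp: g_def sum_incidence_vector\<close>)
    have "connected_graph (induced G (verts G))"
      using assms(2) unfolding connected_induced_iff by (simp add: connected_graph_iff_reachable)
    \<comment> \<open>The empty vertex set is connected by convention; its empty cut puts the origin
      into the polytope.\<close>
    then have "is_bond G {}"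
      unfolding is_bond_def
      by (intro exI[of _ "{}"]) (simp add: cut_def connected_induced_iff)
    then have "incidence_vector {} \<in> bond_polytope G" by (rule P)
    moreover have "incidence_vector {} = (0 :: real ^ ('v set))"
      by (simp add: incidence_vector_def vec_eq_iff)
    ultimately have zero: "0 \<in> bond_polytope G" by simp
    have "g x = 0" if "x \<in> bond_polytope G" for x
      by (rule linear_eq_0_if_eq_0_on_facet[OF assms(4) zero _ lin face that]) auto
    then have eq: "card (edges C \<inter> d) = card (edges C' \<inter> d)" if "is_bond G d" for d
      using P[OF that] by (force simp: g_def sum_incidence_vector)
    \<comment> \<open>The coefficients of \<open>g\<close> as edge weights: the sum over a bond is
      the value of \<open>g\<close> at its incidence vector, hence 0.\<close>
    define w :: "'v set \<Rightarrow> real" where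
      "w e = (if e \<in> edges C then 1 else 0) - (if e \<in> edges C' then 1 else 0)" for e
    have w: "sum w d = 0" if "is_bond G d" for d
      using eq[OF that] by (simp add: w_def sum_subtractf sum.If_cases Int_commute)
    obtain e where "e \<in> edges C" "e \<notin> edges C'"
      using one by (metis card_1_singletonE Diff_iff insertI1)
    moreover have "w e = 0"
      by (rule eq_0_if_sum_bonds_eq_0[OF assms(1,2) _ w]) (use calculation sub in \<open>auto simp: subgraph_def\<close>)
    ultimately show False by (simp add: w_def)
  qed
  then show ?thesis using non unfolding maximal_non_interleaved_def by blast
qed

end
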